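(* Let $\theta\colon\mathbb{Z}\to\mathbb{Z}$, $z\mapsto 0$, be the annihilating homomorphism of the additive group of integers, and let $\tau$ be a Hausdorff locally compact shift-continuous topology on $\mathbf{B}(\mathbb{Z},\theta)^0$ such that the topology induced by $\tau$ on $\mathbf{B}(\mathbb{Z},\theta)$ coincides with $\tau_{-}$. Then the zero $\mathbf{0}$ of $\mathbf{B}(\mathbb{Z},\theta)^0$ is an isolated point of $\left(\mathbf{B}(\mathbb{Z},\theta)^0,\tau\right)$.
   Context: $\mathbb{N}$ is the set of positive integers and $\mathbb{N}_0$ the set of non-negative integers. A topology on a semigroup is shift-continuous if multiplication is separately continuous. The Reilly semigroup $\mathbf{B}(\mathbb{Z},\theta)$ is the set $\mathbb{N}_0\times\mathbb{Z}\times\mathbb{N}_0$ with $$(i,s,j)\cdot(m,t,n)=\left(i+m-\min\{j,m\},\ \theta^{m-\min\{j,m\}}(s)+\theta^{j-\min\{j,m\}}(t),\ j+n-\min\{j,m\}\right),$$ where $\theta^0$ is the identity map and $\theta^k$ is the $k$-fold iterate. $\mathbf{B}(\mathbb{Z},\theta)^0=\mathbf{B}(\mathbb{Z},\theta)\sqcup\{\mathbf{0}\}$ is $\mathbf{B}(\mathbb{Z},\theta)$ with an adjoined zero $\mathbf{0}$. For $A\subseteq\mathbb{Z}$ and $i,j\in\mathbb{N}_0$ put $A_{i,j}=\{(i,s,j)\colon s\in A\}$ and $A_{i,j}^0=A_{i,j}\cup\{(i+1,0,j+1)\}$. The topology $\tau_{-}$ on $\mathbf{B}(\mathbb{Z},\theta)$: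 a point $(i,g,j)$ is isolated if $g\neq 0$, or $i=0$, or $j=0$; for $i,j\in\mathbb{N}$ a base at $(i,0,j)$ consists of all sets $\left((-\mathbb{N})\setminus(-F)\right)_{i-1,j-1}^0$, $F$ a finite subset of $\mathbb{N}$, where $-A=\{-m\colon m\in A\}$. *)

theory Defs
  imports "HOL-Analysis.Analysis"
begin

type_synonym reilly = "nat \<times> int \<times> nat"

text \<open>All differences of natural numbers below are genuine: the subtracted minimum never
  exceeds the minuend.\<close>

fun reilly_mult :: "(int \<Rightarrow> int) \<Rightarrow> reilly \<Rightarrow> reilly \<Rightarrow> reilly" where
  "reilly_mult \<theta> (i, s, j) (m, t, n) =
     (i + m - min j m,
      (\<theta> ^^ (m - min j m)) s + (\<theta> ^^ (j - min j m)) t,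
      j + n - min j m)"

text \<open>The semigroup with adjoined zero lives on \<open>reilly option\<close>, with \<open>None\<close> as the zero.\<close>

fun reilly0_mult :: "(int \<Rightarrow> int) \<Rightarrow> reilly option \<Rightarrow> reilly option \<Rightarrow> reilly option" where
  "reilly0_mult \<theta> (Some x) (Some y) = Some (reilly_mult \<theta> x y)"
| "reilly0_mult \<theta> _ _ = None"

definition shift_continuous :: "('a \<Rightarrow> 'a \<Rightarrow> 'a) \<Rightarrow> 'a topology \<Rightarrow> bool" where
  "shift_continuous f X \<longleftrightarrow>
     (\<forall>a \<in> topspace X. continuous_map X X (\<lambda>x. f a x) \<and> continuous_map X X (\<lambda>x. f x a))"

definition layer :: "int set \<Rightarrow> nat \<Rightarrow> nat \<Rightarrow> reilly set" where
  "layer A i j = {(i, s, j) | s. s \<in> A}"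

definition layer0 :: "int set \<Rightarrow> nat \<Rightarrow> nat \<Rightarrow> reilly set" where
  "layer0 A i j = layer A i j \<union> {(i + 1, 0, j + 1)}"

text \<open>The prescribed base at a point; \<open>{1..}\<close> is the set of positive integers.\<close>

fun tau_minus_base :: "reilly \<Rightarrow> reilly set set" where
  "tau_minus_base (i, g, j) =
     (if g \<noteq> 0 \<or> i = 0 \<or> j = 0 then {{(i, g, j)}}
      else {layer0 (uminus ` {1..} - uminus ` F) (i - 1) (j - 1) | F. finite F \<and> F \<subseteq> {1..}})"

definition tau_minus :: "reilly topology" where
  "tau_minus = topology (\<lambda>U. \<forall>x\<in>U. \<exists>V\<in>tau_minus_base x. V \<subseteq> U)"

lemma funpow_add_hom:
  fixes \<theta> :: "int \<Rightarrow> int"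
  assumes "\<And>x y. \<theta> (x + y) = \<theta> x + \<theta> y"
  shows "(\<theta> ^^ k) (x + y) = (\<theta> ^^ k) x + (\<theta> ^^ k) y"
  using assms by (induction k) simp_all

lemma reilly_mult_assoc:
  assumes "\<And>x y. \<theta> (x + y) = \<theta> x + \<theta> y"
  shows "reilly_mult \<theta> (reilly_mult \<theta> a b) c = reilly_mult \<theta> a (reilly_mult \<theta> b c)"
proof -
  obtain i s j where a: "a = (i, s, j)" by (cases a)
  obtain m t n where b: "b = (m, t, n)" by (cases b)
  obtain p u q where c: "c = (p, u, q)" by (cases c)
  have comp: "(\<theta> ^^ k) ((\<theta> ^^ l) x) = (\<theta> ^^ (k + l)) x" for k l x
    by (simp add: funpow_add)
  consider "j \<le> m" "n \<le> p" | "j \<le> m" "p \<le> n" | "m \<le> j" "n \<le> p" | "m \<le> j" "p \<le> n"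
    by linarith
  then show ?thesis
    by cases
      (auto simp: a b c min_def funpow_add_hom[OF assms] comp
        intro!: arg_cong2[where f = "(+)"] arg_cong[where f = "\<lambda>k. (\<theta> ^^ k) _"])
qed

lemma tau_minus_base_self: "V \<in> tau_minus_base x \<Longrightarrow> x \<in> V"
  by (cases x) (auto simp: layer0_def split: if_splits)

lemma tau_minus_base_Int:
  assumes "V \<in> tau_minus_base x" "W \<in> tau_minus_base x"
  shows "\<exists>Z\<in>tau_minus_base x. Z \<subseteq> V \<inter> W"
proof -
  obtain i g j where x: "x = (i, g, j)" by (cases x)
  show ?thesis
  proof (cases "g \<noteq> 0 \<or> i = 0 \<or> j = 0")
    case True
    then show ?thesis using assms x by auto
  next
    case False
    then obtain F G where F: "finite F" "F \<subseteq> {1..}"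
        "V = layer0 (uminus ` {1..} - uminus ` F) (i - 1) (j - 1)"
      and G: "finite G" "G \<subseteq> {1..}"
        "W = layer0 (uminus ` {1..} - uminus ` G) (i - 1) (j - 1)"
      using assms x by auto
    let ?Z = "layer0 (uminus ` {1..} - uminus ` (F \<union> G)) (i - 1) (j - 1)"
    have "finite (F \<union> G)" "F \<union> G \<subseteq> {1..}" using F G by auto
    then have "?Z \<in> tau_minus_base x" using False x by auto
    moreover have "?Z \<subseteq> V \<inter> W" by (auto simp: F G layer0_def layer_def)
    ultimately show ?thesis by blast
  qed
qed

lemma openin_tau_minus:
  "openin tau_minus U \<longleftrightarrow> (\<forall>x\<in>U. \<exists>V\<in>tau_minus_base x. V \<subseteq> U)"
proof -
  have "istopology (\<lambda>U. \<forall>x\<in>U. \<exists>V\<in>tau_minus_base x. V \<subseteq> U)"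
    unfolding istopology_def
  proof (intro conjI allI impI ballI)
    fix S T x
    assume S: "\<forall>x\<in>S. \<exists>V\<in>tau_minus_base x. V \<subseteq> S" and T: "\<forall>x\<in>T. \<exists>V\<in>tau_minus_base x. V \<subseteq> T"
      and x: "x \<in> S \<inter> T"
    then obtain V W where "V \<in> tau_minus_base x" "V \<subseteq> S" "W \<in> tau_minus_base x" "W \<subseteq> T"
      by blast
    with tau_minus_base_Int[of V x W] show "\<exists>V\<in>tau_minus_base x. V \<subseteq> S \<inter> T"
      by blast
  next
    fix \<K> x
    assume K: "\<forall>K\<in>\<K>. \<forall>x\<in>K. \<exists>V\<in>tau_minus_base x. V \<subseteq> K" and "x \<in> \<Union>\<K>"
    then obtain L where "L \<in> \<K>" "x \<in> L" by blast
    with K obtain V where "V \<in> tau_minus_base x" "V \<subseteq> L" by blast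
    with \<open>L \<in> \<K>\<close> show "\<exists>V\<in>tau_minus_base x. V \<subseteq> \<Union>\<K>" by blast
  qed
  then show ?thesis by (simp add: tau_minus_def topology_inverse')
qed

lemma openin_tau_minus_base:
  assumes "V \<in> tau_minus_base x"
  shows "openin tau_minus V"
  unfolding openin_tau_minus
proof
  fix y assume y: "y \<in> V"
  show "\<exists>W\<in>tau_minus_base y. W \<subseteq> V"
  proof (cases "y = x")
    case True
    then show ?thesis using assms by blast
  next
    case False
    then have "{y} \<in> tau_minus_base y"
      using assms y by (cases x) (auto simp: layer0_def layer_def split: if_splits)
    then show ?thesis using y by blast
  qed
qed

lemma topspace_tau_minus: "topspace tau_minus = UNIV"
proof -
  have "\<exists>V. V \<in> tau_minus_base x" for x
    by (cases x) auto
  then have "openin tau_minus UNIV" by (auto simp: openin_tau_minus)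
  then show ?thesis by (metis openin_subset top.extremum_uniqueI)
qed

end

theory Submission
  imports Defs
begin

text \<open>Call the set of all \<open>(i, s, j)\<close> with \<open>i\<close> and \<open>j\<close> fixed a layer, and let \<open>K\<close> be a compact
  neighbourhood of the zero. Removing any open neighbourhood of the zero from \<open>K\<close> leaves a compact
  set of nonzero elements, and such a set meets only finitely many layers and contains only finitely
  many elements with positive middle coordinate (\<open>compactin_tau_minus_finite\<close>,
  \<open>compactin_diff_nhd_zero\<close>).

  A translation maps the zero to itself, so it maps \<open>K\<close> into \<open>K\<close> except on finitely many layers
  (\<open>translation_almost_preserves\<close>). Translations by \<open>(1, 0, 0)\<close> and \<open>(0, 0, 1)\<close> on either side move
  layers to adjacent ones without changing the middle coordinate. The index set
  \<open>\<nat>\<^sub>0 \<times> \<nat>\<^sub>0\<close> stays connected under unit steps when a finite square at the origin is removed, so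
  outside such a square all layers have the same trace \<open>T \<subseteq> \<int>\<close> on \<open>K\<close>. Left
  translations by \<open>(0, 1, 0)\<close> and \<open>(0, -1, 0)\<close> shift the layers with \<open>i = 0\<close>, so \<open>T\<close> is
  invariant under shifts: \<open>T = \<int>\<close> or \<open>T = \<emptyset>\<close>.

  Since \<open>\<theta>\<close> annihilates, right multiplication by \<open>(j + 1, 0, 0)\<close> collapses the layer with indices
  \<open>i\<close>, \<open>j\<close> to a single nonzero element; hence the zero is not in the closure of any layer
  (\<open>layer_apart_from_zero\<close>). If \<open>T = \<int>\<close>, then \<open>K\<close> contains a whole layer, and so infinitely many
  elements with positive middle coordinate outside a neighbourhood of the zero, which is
  impossible. Hence
  \<open>T = \<emptyset>\<close>, so \<open>K\<close> meets finitely many layers only; avoiding each of them leaves an open set that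
  contains nothing but the zero.\<close>

text \<open>Every point has a basic neighbourhood that meets at most two layers and has at most one
  element with positive middle coordinate; finitely many of these cover a compact set.\<close>

lemma compactin_tau_minus_finite:
  assumes "compactin tau_minus C"
  shows "finite {(i, j). \<exists>s. (i, s, j) \<in> C}" and "finite {(i, s, j). (i, s, j) \<in> C \<and> s > 0}"
proof -
  define small :: "reilly set \<Rightarrow> bool" where
    "small V \<longleftrightarrow> finite ((\<lambda>(i, s, j). (i, j)) ` V) \<and> finite {(i, s, j). (i, s, j) \<in> V \<and> s > 0}" for V
  have small_nhd: "\<exists>V\<in>tau_minus_base x. small V" for x
  proof -
    obtain i g j where x: "x = (i, g, j)" by (cases x)
    show ?thesis
    proof (cases "g \<noteq> 0 \<or> i = 0 \<or> j = 0")
      case True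
      have "finite {(i', s, j'). (i', s, j') \<in> {x} \<and> s > 0}"
        by (rule finite_subset[of _ "{x}"]) auto
      then show ?thesis using True x by (auto simp: small_def)
    next
      case False
      let ?V = "layer0 (uminus ` {1..} - uminus ` {}) (i - 1) (j - 1)"
      have "?V \<in> tau_minus_base x"
        using False x by (auto simp del: image_empty intro!: exI[of _ "{}"])
      moreover have "(\<lambda>(i, s, j). (i, j)) ` ?V \<subseteq> {(i - 1, j - 1), (i, j)}"
        using False by (auto simp: layer0_def layer_def)
      moreover have "{(i', s, j'). (i', s, j') \<in> ?V \<and> s > 0} \<subseteq> {x}"
        by (auto simp: layer0_def layer_def)
      ultimately show ?thesis
        unfolding small_def by (meson finite.emptyI finite.insertI finite_subset)
    qed
  qed
  define \<U> where "\<U> = {V. openin tau_minus V \<and> small V}"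
  have "C \<subseteq> \<Union>\<U>"
  proof
    fix x
    obtain V where "V \<in> tau_minus_base x" "small V" using small_nhd by blast
    then show "x \<in> \<Union>\<U>"
      using openin_tau_minus_base[of V x] tau_minus_base_self[of V x]
      unfolding \<U>_def by blast
  qed
  then obtain \<F> where F: "finite \<F>" "\<F> \<subseteq> \<U>" "C \<subseteq> \<Union>\<F>"
    using compactinD[OF assms, of \<U>] by (auto simp: \<U>_def)
  have "{(i, j). \<exists>s. (i, s, j) \<in> C} \<subseteq> (\<Union>V\<in>\<F>. (\<lambda>(i, s, j). (i, j)) ` V)"
  proof clarify
    fix i s j assume "(i, s, j) \<in> C"
    then obtain V where "V \<in> \<F>" "(i, s, j) \<in> V" using F(3) by blast
    then show "(i, j) \<in> (\<Union>V\<in>\<F>. (\<lambda>(i, s, j). (i, j)) ` V)"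
      by (intro UN_I[of V] image_eqI[of _ _ "(i, s, j)"]) auto
  qed
  moreover have "finite (\<Union>V\<in>\<F>. (\<lambda>(i, s, j). (i, j)) ` V)"
    using F(1,2) by (auto simp: \<U>_def small_def)
  ultimately show "finite {(i, j). \<exists>s. (i, s, j) \<in> C}" by (rule finite_subset)
  have "{(i, s, j). (i, s, j) \<in> C \<and> s > 0} \<subseteq> (\<Union>V\<in>\<F>. {(i, s, j). (i, s, j) \<in> V \<and> s > 0})"
    using F(3) by blast
  moreover have "finite (\<Union>V\<in>\<F>. {(i, s, j). (i, s, j) \<in> V \<and> s > 0})"
    using F(1,2) by (auto simp: \<U>_def small_def)
  ultimately show "finite {(i, s, j). (i, s, j) \<in> C \<and> s > 0}" by (rule finite_subset)
qed

lemma compactin_diff_nhd_zero: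
  assumes "embedding_map tau_minus \<tau> Some"
    and "compactin \<tau> K" "openin \<tau> W" "None \<in> W"
  shows "compactin tau_minus (Some -` (K - W))"
proof -
  have img: "Some ` (Some -` (K - W)) = K - W"
  proof -
    have "K - W \<subseteq> range Some"
      using assms(4) by (metis DiffE notin_range_Some subsetI)
    then show ?thesis by blast
  qed
  have "compactin \<tau> (K \<inter> (topspace \<tau> - W))"
    using assms(2,3) by (intro compact_Int_closedin) auto
  moreover have "K \<inter> (topspace \<tau> - W) = K - W"
    using compactin_subset_topspace[OF assms(2)] by blast
  ultimately have "compactin \<tau> (K - W)" by simp
  moreover have "K - W \<subseteq> range Some" using img by blast
  ultimately have "compactin (subtopology \<tau> (range Some)) (K - W)"
    by (simp add: compactin_subtopology)
  then show ?thesis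
    using assms(1) homeomorphic_map_compactness_eq[of tau_minus _ Some "Some -` (K - W)"]
    by (simp add: embedding_map_def topspace_tau_minus img
      del: image_vimage_eq)
qed

text \<open>A continuous \<open>\<phi>\<close> fixing the zero sends a whole neighbourhood of it into \<open>K\<close>; the part of \<open>K\<close>
  outside that neighbourhood is compact and avoids the zero, hence meets finitely many layers. The
  lemma is applied to translations of the semigroup.\<close>

lemma translation_almost_preserves:
  assumes "embedding_map tau_minus \<tau> Some"
    and "compactin \<tau> K" "openin \<tau> U" "None \<in> U" "U \<subseteq> K"
    and "continuous_map \<tau> \<tau> \<phi>" "\<phi> None = None"
  shows "finite {(i, j). \<exists>s. Some (i, s, j) \<in> K \<and> \<phi> (Some (i, s, j)) \<notin> K}"
proof -
  define W where "W = {x \<in> topspace \<tau>. \<phi> x \<in> U}"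
  have "openin \<tau> W"
    unfolding W_def using assms(3,6) by (simp add: openin_continuous_map_preimage)
  moreover have "None \<in> W"
    using assms openin_subset[OF assms(3)] by (auto simp: W_def)
  ultimately have "finite {(i, j). \<exists>s. (i, s, j) \<in> Some -` (K - W)}"
    using assms compactin_tau_minus_finite(1) compactin_diff_nhd_zero by meson
  then show ?thesis
    by (rule rev_finite_subset) (use assms(5) in \<open>auto simp: W_def\<close>)
qed

text \<open>Right multiplication by \<open>(j + 1, 0, 0)\<close> applies \<open>\<theta>\<close> once to the middle coordinate of
  \<open>(i, s, j)\<close> and so forgets \<open>s\<close>: the layer is sent to the point \<open>(i + 1, 0, 0)\<close>. As the zero is
  fixed, the preimage of the complement of that point separates it from the layer.\<close>

lemma layer_apart_from_zero:
  assumes "topspace \<tau> = UNIV" "t1_space \<tau>"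
    and "shift_continuous (reilly0_mult (\<lambda>z. 0)) \<tau>"
  shows "\<exists>W. openin \<tau> W \<and> None \<in> W \<and> (\<forall>s. Some (i, s, j) \<notin> W)"
proof -
  define \<phi> where "\<phi> x = reilly0_mult (\<lambda>z. 0) x (Some (j + 1, 0, 0))" for x
  have cont: "continuous_map \<tau> \<tau> \<phi>"
    using assms(1,3) unfolding shift_continuous_def \<phi>_def by simp
  have "openin \<tau> (UNIV - {Some (i + 1, 0, 0)})"
    using assms(1,2) by (metis UNIV_I closedin_def closedin_t1_singleton)
  then have "openin \<tau> {x \<in> topspace \<tau>. \<phi> x \<in> UNIV - {Some (i + 1, 0, 0)}}"
    using cont by (rule openin_continuous_map_preimage[rotated])
  moreover have "\<phi> (Some (i, s, j)) = Some (i + 1, 0, 0)" for s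
    by (simp add: \<phi>_def)
  moreover have "\<phi> None = None" by (simp add: \<phi>_def)
  ultimately show ?thesis
    by (intro exI[of _ "{x \<in> topspace \<tau>. \<phi> x \<in> UNIV - {Some (i + 1, 0, 0)}}"])
       (simp add: assms(1))
qed

text \<open>The combinatorial core: deleting a finite square leaves the grid \<open>\<nat> \<times> \<nat>\<close> connected under
  unit steps, so a property constant along unit steps there is constant.\<close>

lemma grid_outside_square_constant:
  fixes P :: "nat \<Rightarrow> nat \<Rightarrow> bool"
  assumes right: "\<And>i j. i \<ge> N \<or> j \<ge> N \<Longrightarrow> P (Suc i) j = P i j"
    and up: "\<And>i j. i \<ge> N \<or> j \<ge> N \<Longrightarrow> P i (Suc j) = P i j"
    and out: "i \<ge> N \<or> j \<ge> N"
  shows "P i j = P 0 N"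
proof -
  have up_add: "P i (j + k) = P i j" if "i \<ge> N \<or> j \<ge> N" for i j k
    using that by (induction k) (auto simp: up)
  have right_add: "P k j = P 0 j" if "j \<ge> N" for j k
    using that by (induction k) (auto simp: right)
  \<comment> \<open>Climb above the square, move to the column \<open>0\<close>, and descend to height \<open>N\<close>.\<close>
  have "P i j = P i (j + N)" using up_add out by blast
  also have "\<dots> = P 0 (N + j)" using right_add[of "j + N" i] by (simp add: add.commute)
  also have "\<dots> = P 0 N" using up_add[of 0 N j] by simp
  finally show ?thesis .
qed

lemma shift_invariant_int_constant:
  fixes P :: "int \<Rightarrow> bool"
  assumes "\<And>s. P s \<Longrightarrow> P (s + 1)" "\<And>s. P s \<Longrightarrow> P (s - 1)" "P s"
  shows "P t"
  by (induction t rule: int_induct[of _ s]) (use assms in auto)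

theorem theorem4p17:
  fixes \<theta> :: "int \<Rightarrow> int" and \<tau> :: "reilly option topology"
  assumes "\<theta> = (\<lambda>z. 0)"
    and "topspace \<tau> = UNIV"
    and "Hausdorff_space \<tau>"
    and "locally_compact_space \<tau>"
    and "shift_continuous (reilly0_mult \<theta>) \<tau>"
    and "embedding_map tau_minus \<tau> Some"
  shows "openin \<tau> {None}"
proof -
  obtain U K where U: "openin \<tau> U" "None \<in> U" "U \<subseteq> K" and K: "compactin \<tau> K"
    using assms(2,4) unfolding locally_compact_space_def by (metis UNIV_I)
  define bad where
    "bad \<phi> = {(i, j). \<exists>s. Some (i, s, j) \<in> K \<and> \<phi> (Some (i, s, j)) \<notin> K}"
    for \<phi> :: "reilly option \<Rightarrow> reilly option"
  define L where "L a x = reilly0_mult \<theta> (Some a) x" for a x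
  define R where "R a x = reilly0_mult \<theta> x (Some a)" for a x
  have "continuous_map \<tau> \<tau> (L a)" "continuous_map \<tau> \<tau> (R a)" for a
    using assms(2,5) by (simp_all add: L_def[abs_def] R_def[abs_def] shift_continuous_def)
  moreover have "L a None = None" "R a None = None" for a
    by (simp_all add: L_def R_def)
  ultimately have fin: "finite (bad (L a))" "finite (bad (R a))" for a
    unfolding bad_def using translation_almost_preserves[OF assms(6) K U] by blast+
  \<comment> \<open>The first two translations raise and lower \<open>i\<close>, the last two raise and lower \<open>j\<close>, and the
    middle two shift \<open>s\<close> on layers with \<open>i = 0\<close>.\<close>
  define E where "E = bad (L (1, 0, 0)) \<union> bad (L (0, 0, 1)) \<union> bad (L (0, 1, 0))
      \<union> bad (L (0, -1, 0)) \<union> bad (R (0, 0, 1)) \<union> bad (R (1, 0, 0))"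
  have E: "bad (L (1, 0, 0)) \<subseteq> E" "bad (L (0, 0, 1)) \<subseteq> E" "bad (L (0, 1, 0)) \<subseteq> E"
      "bad (L (0, -1, 0)) \<subseteq> E" "bad (R (0, 0, 1)) \<subseteq> E" "bad (R (1, 0, 0)) \<subseteq> E"
    by (auto simp: E_def)
  have "finite E" unfolding E_def using fin by blast
  then obtain N where N: "\<And>i j. (i, j) \<in> E \<Longrightarrow> i < N \<and> j < N"
  proof -
    have "finite (fst ` E \<union> snd ` E)" using \<open>finite E\<close> by simp
    then obtain N where "\<forall>n\<in>fst ` E \<union> snd ` E. n < N"
      using finite_nat_set_iff_bounded by blast
    then show ?thesis by (intro that[of N]) force
  qed
  define T where "T s i j \<longleftrightarrow> Some (i, s, j) \<in> K" for s i j
  have step: "\<phi> (Some (i, s, j)) \<in> K" if "i \<ge> N \<or> j \<ge> N" "T s i j" "bad \<phi> \<subseteq> E" for \<phi> i j s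
  proof -
    have "(i, j) \<notin> bad \<phi>" using that N[of i j] by fastforce
    then show ?thesis using that(2) by (auto simp: bad_def T_def)
  qed
  have theta_pow_zero: "((\<lambda>z :: int. 0 :: int) ^^ k) 0 = 0" for k
    by (induction k) auto
  have right: "T s (Suc i) j = T s i j" if "i \<ge> N \<or> j \<ge> N" for s i j
  proof
    show "T s i j" if "T s (Suc i) j"
      using step[OF _ that E(2)] \<open>i \<ge> N \<or> j \<ge> N\<close>
      by (auto simp: L_def assms(1) T_def theta_pow_zero)
    show "T s (Suc i) j" if "T s i j"
      using step[OF _ that E(1)] \<open>i \<ge> N \<or> j \<ge> N\<close>
      by (auto simp: L_def assms(1) T_def theta_pow_zero)
  qed
  have up: "T s i (Suc j) = T s i j" if "i \<ge> N \<or> j \<ge> N" for s i j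
  proof
    show "T s i j" if "T s i (Suc j)"
      using step[OF _ that E(6)] \<open>i \<ge> N \<or> j \<ge> N\<close>
      by (auto simp: R_def assms(1) T_def theta_pow_zero)
    show "T s i (Suc j)" if "T s i j"
      using step[OF _ that E(5)] \<open>i \<ge> N \<or> j \<ge> N\<close>
      by (auto simp: R_def assms(1) T_def theta_pow_zero)
  qed
  have const: "T s i j = T s 0 N" if "i \<ge> N \<or> j \<ge> N" for s i j
    using grid_outside_square_constant[of N "T s"] right up that by blast
  have shift: "T (s + 1) 0 N" "T (s - 1) 0 N" if "T s 0 N" for s
    using step[OF _ that E(3)] step[OF _ that E(4)]
    by (auto simp: L_def assms(1) T_def theta_pow_zero add.commute)
  have apart: "\<exists>W. openin \<tau> W \<and> None \<in> W \<and> (\<forall>s. Some (i, s, j) \<notin> W)" for i j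
    using layer_apart_from_zero assms(1,2,3,5) Hausdorff_imp_t1_space by blast
  have empty: "\<not> T s 0 N" for s
  proof
    assume "T s 0 N"
    then have full: "T t 0 N" for t
      using shift_invariant_int_constant[of "\<lambda>s. T s 0 N"] shift by blast
    obtain W where W: "openin \<tau> W" "None \<in> W" "\<And>s. Some (0, s, N) \<notin> W"
      using apart by blast
    let ?P = "{(i, s, j). (i, s, j) \<in> Some -` (K - W) \<and> s > 0}"
    have "finite ?P"
      using compactin_diff_nhd_zero[OF assms(6) K W(1,2)] by (rule compactin_tau_minus_finite(2))
    moreover have "(\<lambda>s. (0, s, N)) ` {0<..} \<subseteq> ?P"
      using full W(3) by (auto simp: T_def)
    ultimately have "finite ((\<lambda>s::int. (0::nat, s, N)) ` {0<..})"
      by (rule rev_finite_subset)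
    then have "finite {0::int<..}"
      by (rule finite_imageD) (simp add: inj_on_def)
    then show False by (simp add: infinite_Ioi)
  qed
  have inside: "i < N \<and> j < N" if "Some (i, s, j) \<in> K" for i s j
    using const[of i j s] empty[of s] that unfolding T_def by force
  obtain W where W: "\<And>i j. openin \<tau> (W i j)" "\<And>i j. None \<in> W i j"
      "\<And>i j s. Some (i, s, j) \<notin> W i j"
    using apart by metis
  define V where "V = \<Inter>(insert U ((\<lambda>(i, j). W i j) ` ({..<N} \<times> {..<N})))"
  have "openin \<tau> V"
    unfolding V_def using U(1) W(1) by (intro openin_Inter) auto
  moreover have "V = {None}"
  proof
    show "{None} \<subseteq> V" using U(2) W(2) by (auto simp: V_def)
    show "V \<subseteq> {None}"
    proof
      fix x assume x: "x \<in> V"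
      show "x \<in> {None}"
      proof (cases x)
        case (Some y)
        obtain i s j where y: "y = (i, s, j)" by (cases y)
        have "x \<in> K" using x U(3) by (auto simp: V_def)
        then have "i < N \<and> j < N" using inside Some y by blast
        then have "x \<in> W i j" using x by (auto simp: V_def)
        then show ?thesis using W(3) Some y by blast
      qed simp
    qed
  qed
  ultimately show ?thesis by simp
qed

end
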